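(* Let $\kappa$ be a measurable cardinal and $U$ a non-principal $\kappa$-complete ultrafilter over $\kappa$. Then the Mathias forcing $\mathbb{M}_U$ adds a function $f:\kappa\to\kappa$ such that for every ground-model function $g:\kappa\to\kappa$, $g\leq^* f$. In particular, $U$ is not Canjar.
   Context: $\mathbb{M}_U$ consists of pairs $\langle a,A\rangle$ with $a\in[\kappa]^{<\kappa}$, $A\in U$, $\min A>\sup a$, ordered by $\langle a,A\rangle\le\langle b,B\rangle$ iff $b$ is an initial segment of $a$, $a\setminus b\subseteq B$ and $A\subseteq B$. For $f,g:\kappa\to\kappa$, $g\le^* f$ means $g(\alpha)\le f(\alpha)$ for all but boundedly many $\alpha<\kappa$. $U$ is Canjar if $\mathbb{M}_U$ does not add a function $\kappa\to\kappa$ that $\le^*$-dominates every ground-model function $\kappa\to\kappa$. *)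

theory Defs
  imports Main
begin

unbundle cardinal_syntax

text \<open>
  A cardinal \<open>\<kappa>\<close> is a type \<open>'k\<close> of class \<open>wellorder\<close> whose order has the order type of an initial
  ordinal; the ordinals below \<open>\<kappa>\<close> are the elements of \<open>'k\<close>, and functions from \<open>\<kappa>\<close> to \<open>\<kappa>\<close> in
  the ground model are the elements of \<open>'k \<Rightarrow> 'k\<close>.
\<close>

definition ultrafilter_over :: "'a set set \<Rightarrow> bool" where
  "ultrafilter_over U \<longleftrightarrow>
     UNIV \<in> U \<and> {} \<notin> U \<and>
     (\<forall>A\<in>U. \<forall>B\<in>U. A \<inter> B \<in> U) \<and>
     (\<forall>A\<in>U. \<forall>B. A \<subseteq> B \<longrightarrow> B \<in> U) \<and>
     (\<forall>A. A \<in> U \<or> - A \<in> U)"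

definition nonprincipal :: "'a set set \<Rightarrow> bool" where
  "nonprincipal U \<longleftrightarrow> \<not> (\<exists>x. U = {A. x \<in> A})"

definition kappa_complete :: "'a set set \<Rightarrow> bool" where
  "kappa_complete U \<longleftrightarrow> (\<forall>S. S \<subseteq> U \<and> |S| <o |UNIV :: 'a set| \<longrightarrow> \<Inter>S \<in> U)"

definition measurable_cardinal :: "'k::wellorder itself \<Rightarrow> bool" where
  "measurable_cardinal _ \<longleftrightarrow>
     card_order {(x :: 'k, y). x \<le> y} \<and>
     natLeq <o |UNIV :: 'k set| \<and>
     (\<exists>U :: 'k set set. ultrafilter_over U \<and> nonprincipal U \<and> kappa_complete U)"

text \<open>
  Names over a set of conditions: a name is a set of pairs (name, condition), presented as empty
  or as the range of a family indexed by \<open>'i\<close>. Thus \<open>('i, 'p) pname\<close> contains the names that hereditarily have at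
  most \<open>|'i|\<close> elements.
\<close>

datatype ('i, 'p) pname = EmptyName | PName "'i \<Rightarrow> ('i, 'p) pname" "'i \<Rightarrow> 'p"

primrec elts :: "('i, 'p) pname \<Rightarrow> (('i, 'p) pname \<times> 'p) set" where
  "elts EmptyName = {}"
| "elts (PName s c) = range (\<lambda>i. (s i, c i))"

text \<open>Meaningful for sets \<open>S\<close> with at most \<open>|'i|\<close> elements.\<close>

definition name_of :: "(('i, 'p) pname \<times> 'p) set \<Rightarrow> ('i, 'p) pname" where
  "name_of S = (SOME x. elts x = S)"

lemma elts_name_of:
  fixes S :: "(('i, 'p) pname \<times> 'p) set"
  assumes "|S| \<le>o |UNIV :: 'i set|"
  shows "elts (name_of S) = S"
proof -
  have "\<exists>x :: ('i, 'p) pname. elts x = S"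
  proof (cases "S = {}")
    case True
    then have "elts (EmptyName :: ('i, 'p) pname) = S" by simp
    then show ?thesis ..
  next
    case False
    with assms obtain f :: "'i \<Rightarrow> _" where "S = range f"
      using card_of_ordLeq2[of S "UNIV :: 'i set"] by blast
    then have "elts (PName (fst \<circ> f) (snd \<circ> f)) = S" by simp
    then show ?thesis ..
  qed
  then show ?thesis
    unfolding name_of_def by (rule someI_ex)
qed

text \<open>
  The forcing relation. A statement of the forcing language is represented by the set of conditions
  forcing it (as a predicate); \<open>q \<preceq> p\<close> means that \<open>q\<close> is the stronger condition. Implication
  and existential quantification are the classical abbreviations.
\<close>

locale forcing_notion =
  fixes P :: "'p set" and le :: "'p \<Rightarrow> 'p \<Rightarrow> bool"  (infix "\<preceq>" 50)
begin

definition dense_below :: "('p \<Rightarrow> bool) \<Rightarrow> 'p \<Rightarrow> bool" where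
  "dense_below D p \<longleftrightarrow> (\<forall>q\<in>P. q \<preceq> p \<longrightarrow> (\<exists>r\<in>P. r \<preceq> q \<and> D r))"

primrec is_name :: "('i, 'p) pname \<Rightarrow> bool" where
  "is_name EmptyName \<longleftrightarrow> True"
| "is_name (PName s c) \<longleftrightarrow> (\<forall>i. c i \<in> P \<and> is_name (s i))"

text \<open>
  \<open>p\<close> forces \<open>x = y\<close> iff \<open>p\<close> forces \<open>x \<subseteq> y\<close> and \<open>y \<subseteq> x\<close>, with forced membership (defined next)
  unfolded to keep the recursion structural.
\<close>

primrec f_eq :: "('i, 'p) pname \<Rightarrow> ('i, 'p) pname \<Rightarrow> 'p \<Rightarrow> bool" where
  "f_eq EmptyName y p \<longleftrightarrow>
     (\<forall>(w, t) \<in> elts y. \<forall>q\<in>P. q \<preceq> p \<and> q \<preceq> t \<longrightarrow> dense_below (\<lambda>r. False) q)"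
| "f_eq (PName s c) y p \<longleftrightarrow>
     (\<forall>i. \<forall>q\<in>P. q \<preceq> p \<and> q \<preceq> c i \<longrightarrow>
        dense_below (\<lambda>r. \<exists>(w, t) \<in> elts y. r \<preceq> t \<and> f_eq (s i) w r) q) \<and>
     (\<forall>(w, t) \<in> elts y. \<forall>q\<in>P. q \<preceq> p \<and> q \<preceq> t \<longrightarrow>
        dense_below (\<lambda>r. \<exists>i. r \<preceq> c i \<and> f_eq (s i) w r) q)"

definition f_mem :: "('i, 'p) pname \<Rightarrow> ('i, 'p) pname \<Rightarrow> 'p \<Rightarrow> bool" where
  "f_mem x y = dense_below (\<lambda>r. \<exists>(w, t) \<in> elts y. r \<preceq> t \<and> f_eq x w r)"

lemma f_eq_sym: "f_eq x y p \<longleftrightarrow> f_eq y x p"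
proof (induction x arbitrary: y p)
  case EmptyName
  show ?case by (cases y) auto
next
  case (PName s c)
  have *: "f_eq (s i) w r \<longleftrightarrow> f_eq w (s i) r" for i w r
    using PName by auto
  show ?case
    by (cases y) (auto simp: *)
qed

lemma f_eq_iff:
  "f_eq x y p \<longleftrightarrow>
     (\<forall>(z, s) \<in> elts x. \<forall>q\<in>P. q \<preceq> p \<and> q \<preceq> s \<longrightarrow> f_mem z y q) \<and>
     (\<forall>(w, t) \<in> elts y. \<forall>q\<in>P. q \<preceq> p \<and> q \<preceq> t \<longrightarrow> f_mem w x q)"
proof (cases x)
  case EmptyName
  then show ?thesis by (simp add: f_mem_def)
next
  case (PName s c)
  have *: "f_eq (s i) w r \<longleftrightarrow> f_eq w (s i) r" for i w r
    by (rule f_eq_sym)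
  show ?thesis
    unfolding PName f_mem_def by (simp add: *)
qed

definition f_and :: "('p \<Rightarrow> bool) \<Rightarrow> ('p \<Rightarrow> bool) \<Rightarrow> 'p \<Rightarrow> bool" where
  "f_and \<phi> \<psi> p \<longleftrightarrow> \<phi> p \<and> \<psi> p"

definition f_not :: "('p \<Rightarrow> bool) \<Rightarrow> 'p \<Rightarrow> bool" where
  "f_not \<phi> p \<longleftrightarrow> (\<forall>q\<in>P. q \<preceq> p \<longrightarrow> \<not> \<phi> q)"

definition f_all :: "'x set \<Rightarrow> ('x \<Rightarrow> 'p \<Rightarrow> bool) \<Rightarrow> 'p \<Rightarrow> bool" where
  "f_all X \<Phi> p \<longleftrightarrow> (\<forall>x\<in>X. \<Phi> x p)"

definition f_imp :: "('p \<Rightarrow> bool) \<Rightarrow> ('p \<Rightarrow> bool) \<Rightarrow> 'p \<Rightarrow> bool" where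
  "f_imp \<phi> \<psi> = f_not (f_and \<phi> (f_not \<psi>))"

definition f_ex :: "'x set \<Rightarrow> ('x \<Rightarrow> 'p \<Rightarrow> bool) \<Rightarrow> 'p \<Rightarrow> bool" where
  "f_ex X \<Phi> = f_not (f_all X (\<lambda>x. f_not (\<Phi> x)))"

text \<open>An absolute statement about ground-model objects is forced iff it is true.\<close>

definition f_ground :: "bool \<Rightarrow> 'p \<Rightarrow> bool" where
  "f_ground b p \<longleftrightarrow> b"

definition forced :: "('p \<Rightarrow> bool) \<Rightarrow> bool" where
  "forced \<phi> \<longleftrightarrow> (\<forall>p\<in>P. \<phi> p)"

text \<open>
  Check names of ordinals below \<open>\<kappa>\<close> and names for unordered and (Kuratowski) ordered pairs. There
  need not be a weakest condition, so all conditions are attached to each element. With index type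
  \<open>'p \<times> 'k\<close>, names have hereditarily at most \<open>|'p| \<cdot> \<kappa>\<close> elements, which is enough for every subset
  of \<open>\<kappa> \<times> \<kappa>\<close> of the extension to have a name.
\<close>

function check :: "'k::wellorder \<Rightarrow> ('p \<times> 'k, 'p) pname" where
  "check \<alpha> = name_of ((\<lambda>\<beta>. check \<beta>) ` {..<\<alpha>} \<times> P)"
  by auto
termination
  by (relation "{(x, y). x < y}") (auto simp: wf)

declare check.simps [simp del]

definition upair_name :: "('i, 'p) pname \<Rightarrow> ('i, 'p) pname \<Rightarrow> ('i, 'p) pname" where
  "upair_name x y = name_of ({x, y} \<times> P)"

definition pair_name :: "('i, 'p) pname \<Rightarrow> ('i, 'p) pname \<Rightarrow> ('i, 'p) pname" where
  "pair_name x y = name_of ({upair_name x x, upair_name x y} \<times> P)"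

text \<open>
  Quantifiers bounded by a ground-model set (\<open>\<kappa>\<close>, or the ground-model functions from \<open>\<kappa>\<close> to \<open>\<kappa>\<close>)
  range over its elements; the quantifier over elements of the extension ranges over names.
\<close>

definition f_val :: "('p \<times> 'k, 'p) pname \<Rightarrow> 'k::wellorder \<Rightarrow> 'k \<Rightarrow> 'p \<Rightarrow> bool" where
  "f_val f \<alpha> \<beta> = f_mem (pair_name (check \<alpha>) (check \<beta>)) f"

definition f_function :: "('p \<times> 'k::wellorder, 'p) pname \<Rightarrow> 'p \<Rightarrow> bool" where
  "f_function f =
     f_and (f_all (Collect is_name) (\<lambda>x. f_imp (f_mem x f)
              (f_ex UNIV (\<lambda>\<alpha>. f_ex UNIV (\<lambda>\<beta>. f_eq x (pair_name (check \<alpha>) (check \<beta>)))))))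
    (f_and (f_all UNIV (\<lambda>\<alpha>. f_ex UNIV (\<lambda>\<beta>. f_val f \<alpha> \<beta>)))
           (f_all UNIV (\<lambda>\<alpha>. f_all UNIV (\<lambda>\<beta>. f_all UNIV (\<lambda>\<beta>'.
              f_imp (f_and (f_val f \<alpha> \<beta>) (f_val f \<alpha> \<beta>')) (f_ground (\<beta> = \<beta>')))))))"

definition f_le_star :: "('k \<Rightarrow> 'k) \<Rightarrow> ('p \<times> 'k::wellorder, 'p) pname \<Rightarrow> 'p \<Rightarrow> bool" where
  "f_le_star g f =
     f_ex UNIV (\<lambda>\<gamma>. f_all UNIV (\<lambda>\<alpha>. f_imp (f_ground (\<gamma> \<le> \<alpha>))
       (f_ex UNIV (\<lambda>\<beta>. f_and (f_val f \<alpha> \<beta>) (f_ground (g \<alpha> \<le> \<beta>))))))"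

definition f_dominating :: "('p \<times> 'k::wellorder, 'p) pname \<Rightarrow> 'p \<Rightarrow> bool" where
  "f_dominating f = f_and (f_function f) (f_all UNIV (\<lambda>g. f_le_star g f))"

end

definition ord_sup :: "'k::wellorder set \<Rightarrow> 'k" where
  "ord_sup a = (LEAST s. \<forall>x\<in>a. x \<le> s)"

definition initial_segment :: "'k::wellorder set \<Rightarrow> 'k set \<Rightarrow> bool" where
  "initial_segment b a \<longleftrightarrow> b \<subseteq> a \<and> (\<forall>y\<in>b. \<forall>x\<in>a. x < y \<longrightarrow> x \<in> b)"

text \<open>
  For regular \<open>\<kappa>\<close> (in particular measurable \<open>\<kappa>\<close>) a set of size less than \<open>\<kappa>\<close> is bounded, so that
  its supremum exists in \<open>'k\<close>.
\<close>

definition mathias :: "'k::wellorder set set \<Rightarrow> ('k set \<times> 'k set) set" where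
  "mathias U = {(a, A). |a| <o |UNIV :: 'k set| \<and> A \<in> U \<and> ord_sup a < (LEAST y. y \<in> A)}"

definition mathias_le :: "'k::wellorder set \<times> 'k set \<Rightarrow> 'k set \<times> 'k set \<Rightarrow> bool" where
  "mathias_le = (\<lambda>(a, A) (b, B). initial_segment b a \<and> a - b \<subseteq> B \<and> A \<subseteq> B)"

lemma mathias_le_refl: "mathias_le p p"
  by (auto simp: mathias_le_def initial_segment_def split: prod.splits)

lemma mathias_le_trans: "mathias_le p q \<Longrightarrow> mathias_le q r \<Longrightarrow> mathias_le p r"
  unfolding mathias_le_def initial_segment_def by (clarsimp split: prod.splits) blast

definition mathias_adds_dominating :: "'k::wellorder set set \<Rightarrow> bool" where
  "mathias_adds_dominating U \<longleftrightarrow>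
     forcing_notion.forced (mathias U)
       (forcing_notion.f_ex (mathias U) mathias_le
         (Collect (forcing_notion.is_name (mathias U)))
         (forcing_notion.f_dominating (mathias U) mathias_le ::
           (('k set \<times> 'k set) \<times> 'k, 'k set \<times> 'k set) pname \<Rightarrow> _))"

text \<open>Not adding a dominating function: no generic extension contains one.\<close>

definition canjar :: "'k::wellorder set set \<Rightarrow> bool" where
  "canjar U \<longleftrightarrow>
     forcing_notion.forced (mathias U)
       (forcing_notion.f_not (mathias U) mathias_le
         (forcing_notion.f_ex (mathias U) mathias_le
           (Collect (forcing_notion.is_name (mathias U)))
           (forcing_notion.f_dominating (mathias U) mathias_le ::
             (('k set \<times> 'k set) \<times> 'k, 'k set \<times> 'k set) pname \<Rightarrow> _)))"

end

theory Submission
  imports Defs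
begin

text \<open>
  Let \<open>\<pi>\<close> be minimal modulo \<open>U\<close> among the functions that are not bounded modulo \<open>U\<close>; it exists
  because \<open>U\<close> is countably complete. By minimality, for every \<open>g\<close> the set of all \<open>x\<close> for which
  \<open>\<pi> x\<close> is closed under \<open>g\<close> lies in \<open>U\<close>, so the generic set is contained in it up to a bounded
  set. Hence the function sending \<open>\<alpha>\<close> to \<open>\<pi> x\<close>, for the first generic \<open>x\<close> with \<open>\<alpha> < \<pi> x\<close>,
  dominates \<open>g\<close>.
\<close>

lemma card_of_finite_ordLess_infinite: "finite A \<Longrightarrow> infinite B \<Longrightarrow> |A| <o |B|"
  by (rule finite_ordLess_infinite[OF card_of_Well_order card_of_Well_order])
     (simp_all add: Field_card_of)

section \<open>The forcing relation on names of ordinals and pairs\<close>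

text \<open>Both laws hold on the whole type rather than only on \<open>P\<close>, so that
  monotonicity facts such as \<open>f_eq_mono\<close> need no membership side conditions.\<close>

locale preorder_forcing = forcing_notion P le
  for P :: "'p set" and le :: "'p \<Rightarrow> 'p \<Rightarrow> bool"  (infix "\<preceq>" 50) +
  assumes le_refl: "p \<preceq> p"
    and le_trans: "p \<preceq> q \<Longrightarrow> q \<preceq> r \<Longrightarrow> p \<preceq> r"
begin

text \<open>Each condition below \<open>p\<close> lies below \<open>t\<close> and is its own witness
  to density. Equality is asked for at every \<open>r\<close>, which is what the induction
  hypothesis of \<open>f_eq_refl\<close> provides.\<close>

lemma f_mem_intro:
  assumes "(w, t) \<in> elts y" and "p \<preceq> t" and "\<And>r. f_eq x w r"
  shows "f_mem x y p"
  unfolding f_mem_def dense_below_def using assms le_refl le_trans by fastforce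

lemma f_mem_witness:
  assumes "f_mem x y p" and "p \<in> P"
  obtains r w t where "r \<in> P" "r \<preceq> p" "(w, t) \<in> elts y" "r \<preceq> t" "f_eq x w r"
  using assms le_refl unfolding f_mem_def dense_below_def by blast

lemma f_eq_refl: "f_eq x x p"
proof (induction x arbitrary: p)
  case EmptyName
  then show ?case by simp
next
  case (PName s c)
  have "f_eq z z r" if "(z, t) \<in> elts (PName s c)" for z t r
    using that PName by auto
  then show ?case
    unfolding f_eq_iff[of "PName s c"] by (blast intro: f_mem_intro)
qed

lemma f_eq_mono: "f_eq x y p \<Longrightarrow> q \<preceq> p \<Longrightarrow> f_eq x y q"
  unfolding f_eq_iff[of x y] using le_trans by blast

text \<open>Check names and pair names attach every condition to each element, so for their elements
  the last premise is met at any \<open>p\<close> in \<open>P\<close>.\<close>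

lemma f_eq_memD:
  assumes "f_eq x y p" and "p \<in> P" and "(z, p) \<in> elts x"
  shows "f_mem z y p"
  using assms le_refl unfolding f_eq_iff[of x y] by blast

text \<open>Double negation turns into density; the witness may vary with the condition below
  \<open>p\<close>.\<close>

lemma f_ex_iff:
  "f_ex X \<Phi> p \<longleftrightarrow> (\<forall>q\<in>P. q \<preceq> p \<longrightarrow> (\<exists>x\<in>X. \<exists>r\<in>P. r \<preceq> q \<and> \<Phi> x r))"
  unfolding f_ex_def f_not_def f_all_def by blast

lemma f_imp_iff:
  "f_imp \<phi> \<psi> p \<longleftrightarrow> (\<forall>q\<in>P. q \<preceq> p \<and> \<phi> q \<longrightarrow> (\<exists>r\<in>P. r \<preceq> q \<and> \<psi> r))"
  unfolding f_imp_def f_not_def f_and_def by blast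

section \<open>Small names and check names of ordinals\<close>

lemma is_name_iff: "is_name x \<longleftrightarrow> (\<forall>(w, t)\<in>elts x. t \<in> P \<and> is_name w)"
  by (cases x) auto

text \<open>This is the size bound behind every later use of \<open>elts_name_of\<close>: with index
  type \<open>'p \<times> 'k\<close>, up to \<kappa> many names may each carry arbitrarily many
  conditions.\<close>

lemma card_of_names_le:
  fixes B :: "'x set" and Q :: "'p set"
  assumes "|B| \<le>o |UNIV :: 'k set|"
  shows "|B \<times> Q| \<le>o |UNIV :: ('p \<times> 'k) set|"
proof -
  have "|B \<times> Q| \<le>o |Q \<times> B|"
    by (rule ordIso_imp_ordLeq[OF card_of_Times_commute])
  also have "|Q \<times> B| \<le>o |Q \<times> (UNIV :: 'k set)|"
    using assms by (rule card_of_Times_mono2)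
  also have "|Q \<times> (UNIV :: 'k set)| \<le>o |UNIV :: ('p \<times> 'k) set|"
    by (rule card_of_mono1) simp
  finally show ?thesis .
qed

lemma elts_check:
  "elts (check \<alpha> :: ('p \<times> 'k::wellorder, 'p) pname) = check ` {..<\<alpha>} \<times> P"
proof -
  have "|check ` {..<\<alpha>} :: ('p \<times> 'k, 'p) pname set| \<le>o |UNIV :: 'k set|"
    by (rule ordLeq_transitive[OF card_of_image card_of_mono1]) simp
  then show ?thesis
    by (subst check.simps) (intro elts_name_of card_of_names_le)
qed

lemma is_name_check: "is_name (check \<alpha> :: ('p \<times> 'k::wellorder, 'p) pname)"
proof (induction \<alpha> rule: less_induct)
  case (less \<alpha>)
  then show ?case by (subst is_name_iff) (auto simp: elts_check)
qed

text \<open>If the ordinals differed, the name of the smaller one would be forced to belong to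
  itself. A witness to this membership equates it with the name of a still smaller ordinal, which
  well-foundedness excludes.\<close>

lemma f_eq_check_iff:
  fixes \<alpha> \<beta> :: "'k::wellorder"
  assumes "p \<in> P"
  shows "f_eq (check \<alpha>) (check \<beta>) p \<longleftrightarrow> \<alpha> = \<beta>"
proof
  assume "f_eq (check \<alpha>) (check \<beta>) p"
  then show "\<alpha> = \<beta>" using assms
  proof (induction \<alpha> arbitrary: \<beta> p rule: less_induct)
    case (less \<alpha>)
    show ?case
    proof (rule linorder_cases[of \<alpha> \<beta>])
      assume "\<alpha> < \<beta>"
      then have "f_mem (check \<alpha>) (check \<alpha> :: ('p \<times> 'k, 'p) pname) p"
        using less.prems by (intro f_eq_memD[of "check \<beta>"]) (auto simp: elts_check f_eq_sym)
      then obtain r \<gamma> where "r \<in> P" "\<gamma> < \<alpha>"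
          and "f_eq (check \<alpha>) (check \<gamma> :: ('p \<times> 'k, 'p) pname) r"
        using less.prems by (elim f_mem_witness) (auto simp: elts_check)
      \<comment> \<open>The induction runs over the left ordinal, so symmetry moves the smaller
        \<gamma> to the left.\<close>
      then show ?thesis
        using less.IH[of \<gamma> \<alpha> r] f_eq_sym by blast
    next
      assume "\<beta> < \<alpha>"
      then have "f_mem (check \<beta>) (check \<beta> :: ('p \<times> 'k, 'p) pname) p"
        using less.prems by (intro f_eq_memD[of "check \<alpha>"]) (auto simp: elts_check)
      then obtain r \<gamma> where "r \<in> P" "\<gamma> < \<beta>"
          and "f_eq (check \<beta>) (check \<gamma> :: ('p \<times> 'k, 'p) pname) r"
        using less.prems by (elim f_mem_witness) (auto simp: elts_check)
      then show ?thesis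
        using less.IH[of \<beta> \<gamma> r] \<open>\<beta> < \<alpha>\<close> by blast
    qed
  qed
qed (simp add: f_eq_refl)

section \<open>Names of unordered and ordered pairs\<close>

context
  assumes infinite_index: "infinite (UNIV :: 'k::wellorder set)"
begin

lemma elts_name_of_doubleton:
  "elts (name_of ({x, y} \<times> P) :: ('p \<times> 'k, 'p) pname) = {x, y} \<times> P"
proof (intro elts_name_of card_of_names_le)
  show "|{x, y}| \<le>o |UNIV :: 'k set|"
    by (intro ordLess_imp_ordLeq card_of_finite_ordLess_infinite infinite_index) simp
qed

lemma elts_upair_name: "elts (upair_name x y :: ('p \<times> 'k, 'p) pname) = {x, y} \<times> P"
  unfolding upair_name_def by (rule elts_name_of_doubleton)

lemma elts_pair_name:
  "elts (pair_name x y :: ('p \<times> 'k, 'p) pname) = {upair_name x x, upair_name x y} \<times> P"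
  unfolding pair_name_def by (rule elts_name_of_doubleton)

lemma is_name_pair_check:
  "is_name (pair_name (check \<alpha>) (check \<beta>) :: ('p \<times> 'k, 'p) pname)"
proof -
  have "is_name (upair_name (check \<gamma>) (check \<delta>) :: ('p \<times> 'k, 'p) pname)" for \<gamma> \<delta>
    by (subst is_name_iff) (auto simp: elts_upair_name is_name_check)
  then show ?thesis
    by (subst is_name_iff) (auto simp: elts_pair_name)
qed

lemma f_eq_upair_checkD:
  assumes "f_eq (upair_name (check \<alpha>) (check \<beta>))
      (upair_name (check \<gamma>) (check \<delta>) :: ('p \<times> 'k, 'p) pname) p"
    and "p \<in> P"
  shows "{\<alpha>, \<beta>} = {\<gamma>, \<delta>}"
proof -
  have sub: "{\<alpha>, \<beta>} \<subseteq> {\<gamma>, \<delta>}"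
    if eq: "f_eq (upair_name (check \<alpha>) (check \<beta>))
      (upair_name (check \<gamma>) (check \<delta>) :: ('p \<times> 'k, 'p) pname) p" for \<alpha> \<beta> \<gamma> \<delta>
  proof
    fix \<epsilon> assume "\<epsilon> \<in> {\<alpha>, \<beta>}"
    then have "f_mem (check \<epsilon>) (upair_name (check \<gamma>) (check \<delta>) :: ('p \<times> 'k, 'p) pname) p"
      by (intro f_eq_memD[OF eq \<open>p \<in> P\<close>]) (auto simp: elts_upair_name \<open>p \<in> P\<close>)
    then show "\<epsilon> \<in> {\<gamma>, \<delta>}"
      using \<open>p \<in> P\<close> by (elim f_mem_witness) (auto simp: elts_upair_name f_eq_check_iff)
  qed
  show ?thesis
    using sub assms(1) f_eq_sym by (metis subset_antisym)
qed

lemma f_eq_pair_checkD: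
  assumes "f_eq (pair_name (check \<alpha>) (check \<beta>))
      (pair_name (check \<gamma>) (check \<delta>) :: ('p \<times> 'k, 'p) pname) p"
    and "p \<in> P"
  shows "\<alpha> = \<gamma> \<and> \<beta> = \<delta>"
proof -
  have sub: "{{\<alpha>, \<alpha>}, {\<alpha>, \<beta>}} \<subseteq> {{\<gamma>, \<gamma>}, {\<gamma>, \<delta>}}"
    if eq: "f_eq (pair_name (check \<alpha>) (check \<beta>))
      (pair_name (check \<gamma>) (check \<delta>) :: ('p \<times> 'k, 'p) pname) p" for \<alpha> \<beta> \<gamma> \<delta>
  proof -
    \<comment> \<open>Both components of a Kuratowski pair have the form {\<alpha>, \<epsilon>} with
      \<epsilon> either \<alpha> or \<beta>, so one argument treats them together.\<close>
    have "{\<alpha>, \<epsilon>} \<in> {{\<gamma>, \<gamma>}, {\<gamma>, \<delta>}}" if "\<epsilon> \<in> {\<alpha>, \<beta>}" for \<epsilon>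
    proof -
      have "f_mem (upair_name (check \<alpha>) (check \<epsilon>))
          (pair_name (check \<gamma>) (check \<delta>) :: ('p \<times> 'k, 'p) pname) p"
        using that by (intro f_eq_memD[OF eq \<open>p \<in> P\<close>]) (auto simp: elts_pair_name \<open>p \<in> P\<close>)
      then show ?thesis
        using \<open>p \<in> P\<close>
        by (elim f_mem_witness) (auto simp: elts_pair_name dest!: f_eq_upair_checkD)
    qed
    then show ?thesis by blast
  qed
  have "{{\<alpha>, \<alpha>}, {\<alpha>, \<beta>}} = {{\<gamma>, \<gamma>}, {\<gamma>, \<delta>}}"
    using sub assms(1) f_eq_sym by (metis subset_antisym)
  then show ?thesis
    by (auto simp: doubleton_eq_iff)
qed

section \<open>The name of a function given by coherent decisions\<close>

text \<open>\<open>dec p \<alpha> \<beta>\<close> is read as: \<open>p\<close> settles the value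
  \<beta> at \<alpha>. In the extension the name denotes the union of these relations over the
  generic filter.\<close>

definition function_name :: "('p \<Rightarrow> 'k \<Rightarrow> 'k \<Rightarrow> bool) \<Rightarrow> ('p \<times> 'k, 'p) pname" where
  "function_name dec =
     name_of {(pair_name (check \<alpha>) (check \<beta>), p) | \<alpha> \<beta> p. p \<in> P \<and> dec p \<alpha> \<beta>}"

lemma elts_function_name:
  "elts (function_name dec) =
     {(pair_name (check \<alpha>) (check \<beta>), p) | \<alpha> \<beta> p. p \<in> P \<and> dec p \<alpha> \<beta>}"
    (is "_ = ?S")
proof -
  let ?pair = "\<lambda>(\<alpha>, \<beta>). pair_name (check \<alpha>) (check \<beta>) :: ('p \<times> 'k, 'p) pname"
  have "|range ?pair| \<le>o |UNIV :: ('k \<times> 'k) set|"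
    by (rule card_of_image)
  also have "|UNIV :: ('k \<times> 'k) set| \<le>o |UNIV :: 'k set|"
    using card_of_Times_same_infinite[OF infinite_index]
    by (simp add: ordIso_imp_ordLeq)
  finally have "|range ?pair \<times> P| \<le>o |UNIV :: ('p \<times> 'k) set|"
    by (rule card_of_names_le)
  moreover have "?S \<subseteq> range ?pair \<times> P"
    by auto
  ultimately have "|?S| \<le>o |UNIV :: ('p \<times> 'k) set|"
    using card_of_mono1 ordLeq_transitive by blast
  then show ?thesis
    unfolding function_name_def by (rule elts_name_of)
qed

lemma is_name_function_name: "is_name (function_name dec)"
  by (subst is_name_iff) (auto simp: elts_function_name is_name_pair_check)

lemma f_val_function_name_intro:
  assumes "p \<in> P" and "dec p \<alpha> \<beta>"
  shows "f_val (function_name dec) \<alpha> \<beta> p"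
  unfolding f_val_def using assms
  by (intro f_mem_intro[of "pair_name (check \<alpha>) (check \<beta>)" p])
     (auto simp: elts_function_name le_refl f_eq_refl)

text \<open>Distinct pairs of ordinals never have names forced equal, so a membership witness must
  carry the pair (\<alpha>, \<beta>) itself. The decision belongs to the attached condition
  \<open>t\<close> and passes down to \<open>r\<close> by \<open>mono\<close>.\<close>

lemma f_val_function_name_witness:
  assumes "f_val (function_name dec) \<alpha> \<beta> p" and "p \<in> P"
    and mono: "\<And>q r. q \<preceq> r \<Longrightarrow> dec r \<alpha> \<beta> \<Longrightarrow> dec q \<alpha> \<beta>"
  obtains r where "r \<in> P" "r \<preceq> p" "dec r \<alpha> \<beta>"
proof -
  obtain r w t where r: "r \<in> P" "r \<preceq> p" "(w, t) \<in> elts (function_name dec)" "r \<preceq> t"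
      "f_eq (pair_name (check \<alpha>) (check \<beta>)) w r"
    using assms(1,2) unfolding f_val_def by (rule f_mem_witness)
  then obtain \<gamma> \<delta> where w: "w = pair_name (check \<gamma>) (check \<delta>)" and "dec t \<gamma> \<delta>"
    by (auto simp: elts_function_name)
  moreover have "\<alpha> = \<gamma> \<and> \<beta> = \<delta>"
    using f_eq_pair_checkD r(1,5) unfolding w by blast
  ultimately have "dec r \<alpha> \<beta>"
    using mono r(4) by blast
  then show thesis using that r by blast
qed

lemma f_function_function_name:
  assumes mono: "\<And>p q \<alpha> \<beta>. q \<preceq> p \<Longrightarrow> dec p \<alpha> \<beta> \<Longrightarrow> dec q \<alpha> \<beta>"
    and unique: "\<And>p \<alpha> \<beta> \<beta>'. dec p \<alpha> \<beta> \<Longrightarrow> dec p \<alpha> \<beta>' \<Longrightarrow> \<beta> = \<beta>'"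
    and total: "\<And>p \<alpha>. p \<in> P \<Longrightarrow> \<exists>q\<in>P. q \<preceq> p \<and> (\<exists>\<beta>. dec q \<alpha> \<beta>)"
  shows "f_function (function_name dec) p"
proof -
  have pairs: "\<exists>r\<in>P. r \<preceq> q \<and>
      f_ex UNIV (\<lambda>\<alpha>. f_ex UNIV (\<lambda>\<beta>. f_eq x (pair_name (check \<alpha>) (check \<beta>)))) r"
    if mem: "f_mem x (function_name dec) q" and q: "q \<in> P" for x q
  proof -
    obtain r w t where r: "r \<in> P" "r \<preceq> q" "(w, t) \<in> elts (function_name dec)" "f_eq x w r"
      using mem q by (rule f_mem_witness)
    then obtain \<alpha> \<beta> where "f_eq x (pair_name (check \<alpha>) (check \<beta>)) r"
      by (auto simp: elts_function_name)
    \<comment> \<open>\<open>f_ex\<close> asks for witnesses densely below \<open>r\<close>; the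
      same \<alpha> and \<beta> serve everywhere there.\<close>
    then have "f_eq x (pair_name (check \<alpha>) (check \<beta>)) s" if "s \<preceq> r" for s
      using f_eq_mono that by blast
    then have "f_ex UNIV (\<lambda>\<alpha>. f_ex UNIV (\<lambda>\<beta>. f_eq x (pair_name (check \<alpha>) (check \<beta>)))) r"
      unfolding f_ex_iff using le_refl le_trans by (meson UNIV_I)
    then show ?thesis using r by blast
  qed
  have single: "\<beta> = \<beta>'"
    if v: "f_val (function_name dec) \<alpha> \<beta> q" "f_val (function_name dec) \<alpha> \<beta>' q" and q: "q \<in> P"
    for \<alpha> \<beta> \<beta>' q
  proof -
    \<comment> \<open>The two forced values need not be decided by \<open>q\<close> itself. The
      first is decided below \<open>q\<close>, the second below that, and \<open>mono\<close>
      carries the first decision down.\<close>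
    obtain r where r: "r \<in> P" "r \<preceq> q" "dec r \<alpha> \<beta>"
      using v(1) q by (rule f_val_function_name_witness) (use mono in blast)+
    have "f_val (function_name dec) \<alpha> \<beta>' r"
      using v(2) r(2) le_trans unfolding f_val_def f_mem_def dense_below_def by blast
    then obtain s where "s \<in> P" "s \<preceq> r" "dec s \<alpha> \<beta>'"
      using r(1) by (rule f_val_function_name_witness) (use mono in blast)+
    then show ?thesis
      using unique mono r(3) by blast
  qed
  have "f_ex UNIV (f_val (function_name dec) \<alpha>) p" for \<alpha>
    unfolding f_ex_iff using total f_val_function_name_intro by (metis UNIV_I)
  then show ?thesis
    unfolding f_function_def f_and_def f_all_def f_imp_iff f_ground_def
    using pairs single le_refl by blast
qed

end

end

section \<open>Complete ultrafilters on a cardinal\<close>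

locale complete_ultrafilter =
  fixes U :: "'k::wellorder set set"
  assumes card_order_le: "card_order {(x :: 'k, y). x \<le> y}"
    and uncountable: "natLeq <o |UNIV :: 'k set|"
    and ultrafilter: "ultrafilter_over U"
    and nonprincipal: "nonprincipal U"
    and complete: "kappa_complete U"
begin

lemma infinite_kappa: "infinite (UNIV :: 'k set)"
  using uncountable infinite_iff_natLeq_ordLeq ordLess_imp_ordLeq by blast

lemma U_Int: "A \<in> U \<Longrightarrow> B \<in> U \<Longrightarrow> A \<inter> B \<in> U"
  using ultrafilter unfolding ultrafilter_over_def by blast

lemma U_mono: "A \<in> U \<Longrightarrow> A \<subseteq> B \<Longrightarrow> B \<in> U"
  using ultrafilter unfolding ultrafilter_over_def by blast

lemma U_nonempty: "A \<in> U \<Longrightarrow> A \<noteq> {}"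
  using ultrafilter unfolding ultrafilter_over_def by blast

lemma U_compl: "A \<notin> U \<Longrightarrow> - A \<in> U"
  using ultrafilter unfolding ultrafilter_over_def by blast

lemma U_INT:
  assumes "|S| <o |UNIV :: 'k set|" and "\<And>s. s \<in> S \<Longrightarrow> F s \<in> U"
  shows "(\<Inter>s\<in>S. F s) \<in> U"
proof -
  have "|F ` S| <o |UNIV :: 'k set|"
    using card_of_image assms(1) by (rule ordLeq_ordLess_trans)
  then show ?thesis
    using complete assms(2) unfolding kappa_complete_def by blast
qed

lemma U_compl_singleton: "- {x} \<in> U"
proof (rule ccontr)
  assume "- {x} \<notin> U"
  then have x: "{x} \<in> U" using U_compl by fastforce
  have "A \<in> U \<longleftrightarrow> x \<in> A" for A
    using U_mono[OF x, of A] U_Int[OF x, of A] U_nonempty[of "{x} \<inter> A"] by blast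
  then show False
    using nonprincipal unfolding nonprincipal_def by blast
qed

text \<open>Here the assumption that \<kappa> is an initial ordinal enters: proper initial segments
  of a cardinal order are strictly smaller than the whole.\<close>

lemma card_lessThan: "|{..<x :: 'k}| <o |UNIV :: 'k set|"
proof -
  let ?r = "{(x :: 'k, y). x \<le> y}"
  have "Card_order ?r" and field: "Field ?r = UNIV"
    using card_order_le card_order_on_Card_order by blast+
  then have "|underS ?r x| <o ?r" and "?r =o |UNIV :: 'k set|"
    using card_of_underS[of ?r x] card_of_Field_ordIso[of ?r] ordIso_symmetric by auto
  moreover have "underS ?r x = {..<x}"
    by (auto simp: underS_def)
  ultimately show ?thesis
    using ordLess_ordIso_trans by metis
qed

lemma greaterThan_in_U: "{x<..} \<in> U"
proof -
  have "(\<Inter>y\<in>{..<x}. - {y}) \<in> U"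
    by (intro U_INT card_lessThan U_compl_singleton)
  then have "(\<Inter>y\<in>{..<x}. - {y}) \<inter> - {x} \<in> U"
    using U_compl_singleton by (rule U_Int)
  then show ?thesis
    by (rule U_mono) (force simp: neq_iff)
qed

text \<open>Regularity of \<kappa>, obtained from the ultrafilter: fewer than \<kappa> tails, all in
  \<open>U\<close>, have a common element.\<close>

lemma bounded_if_small:
  assumes "|S| <o |UNIV :: 'k set|"
  shows "\<exists>b. \<forall>s\<in>S. F s \<le> (b :: 'k)"
proof -
  have "(\<Inter>s\<in>S. {F s<..}) \<noteq> {}"
    using assms greaterThan_in_U by (intro U_nonempty U_INT)
  then obtain b where "\<forall>s\<in>S. F s < b"
    by auto
  then show ?thesis
    using less_imp_le by blast
qed

section \<open>The least function unbounded modulo U\<close>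

definition unbounded :: "('k \<Rightarrow> 'k) \<Rightarrow> bool" where
  "unbounded h \<longleftrightarrow> (\<forall>\<delta>. {x. \<delta> < h x} \<in> U)"

text \<open>This is well-foundedness of the ultrapower. Countably many sets of \<open>U\<close>
  share a point, at which a sequence descending modulo \<open>U\<close> would be a descending
  sequence of ordinals.\<close>

lemma wf_less_mod_U: "wf {(h :: 'k \<Rightarrow> 'k, h'). {x. h x < h' x} \<in> U}"
  unfolding wf_iff_no_infinite_down_chain
proof
  assume "\<exists>F :: nat \<Rightarrow> 'k \<Rightarrow> 'k. \<forall>n. (F (Suc n), F n) \<in> {(h, h'). {x. h x < h' x} \<in> U}"
  then obtain F :: "nat \<Rightarrow> 'k \<Rightarrow> 'k" where F: "\<And>n. {x. F (Suc n) x < F n x} \<in> U"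
    by auto
  have "|UNIV :: nat set| <o |UNIV :: 'k set|"
    using card_of_nat uncountable by (rule ordIso_ordLess_trans)
  then have "(\<Inter>n. {x. F (Suc n) x < F n x}) \<in> U"
    using F by (rule U_INT)
  then obtain x where "F (Suc n) x < F n x" for n
    using U_nonempty by blast
  moreover have "wf {(x :: 'k, y). x < y}"
    by (rule wf)
  ultimately show False
    unfolding wf_iff_no_infinite_down_chain by (auto dest: spec[of _ "\<lambda>n. F n x"])
qed

text \<open>The class of \<pi> is minimal in the ultrapower among those above all constants. If
  closure under \<open>g\<close> failed on a set in \<open>U\<close>, choosing counterexamples would
  give a function below \<pi>, hence bounded by some \<delta> modulo \<open>U\<close>; then \<pi>
  would be bounded by a bound of \<open>g\<close> up to \<delta>.\<close>

lemma exists_unbounded_closed: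
  obtains \<pi> where "unbounded \<pi>" and "\<And>g. {x. \<forall>\<alpha><\<pi> x. g \<alpha> < \<pi> x} \<in> U"
proof -
  have "unbounded (\<lambda>x. x)"
    using greaterThan_in_U unfolding unbounded_def greaterThan_def by simp
  then have "(\<lambda>x. x) \<in> Collect unbounded" by simp
  with wf_less_mod_U obtain \<pi> where "\<pi> \<in> Collect unbounded"
    and "\<And>h. (h, \<pi>) \<in> {(h, h'). {x. h x < h' x} \<in> U} \<Longrightarrow> h \<notin> Collect unbounded"
    by (rule wfE_min) blast
  then have \<pi>: "unbounded \<pi>" and minimal: "\<And>h. {x. h x < \<pi> x} \<in> U \<Longrightarrow> \<not> unbounded h"
    by simp_all
  have "{x. \<forall>\<alpha><\<pi> x. g \<alpha> < \<pi> x} \<in> U" for g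
  proof (rule ccontr)
    assume "{x. \<forall>\<alpha><\<pi> x. g \<alpha> < \<pi> x} \<notin> U"
    then have N: "- {x. \<forall>\<alpha><\<pi> x. g \<alpha> < \<pi> x} \<in> U" (is "?N \<in> U")
      by (rule U_compl)
    have "\<forall>x\<in>?N. \<exists>\<alpha>. \<alpha> < \<pi> x \<and> \<pi> x \<le> g \<alpha>"
      by (auto simp: not_less)
    from bchoice[OF this] obtain h where h: "\<forall>x\<in>?N. h x < \<pi> x \<and> \<pi> x \<le> g (h x)" ..
    have "{x. h x < \<pi> x} \<in> U"
      using N by (rule U_mono) (use h in blast)
    then obtain \<delta> where "{x. \<delta> < h x} \<notin> U"
      using minimal unfolding unbounded_def by blast
    then have bound: "- {x. \<delta> < h x} \<in> U"
      by (rule U_compl)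
    \<comment> \<open>\<open>h x\<close> may equal \<delta>, while \<open>b\<close> bounds
      \<open>g\<close> only strictly below it; hence \<open>max b (g \<delta>)\<close> in what
      follows.\<close>
    obtain b where b: "\<And>\<alpha>. \<alpha> < \<delta> \<Longrightarrow> g \<alpha> \<le> b"
      using bounded_if_small[OF card_lessThan] by blast
    have "{x. max b (g \<delta>) < \<pi> x} \<in> U"
      using \<pi> unfolding unbounded_def by blast
    then obtain x where x: "x \<in> ?N" "\<not> \<delta> < h x" "max b (g \<delta>) < \<pi> x"
      using U_nonempty[OF U_Int[OF U_Int[OF N bound]]] by blast
    then have "g (h x) \<le> max b (g \<delta>)"
      using b[of "h x"] by (cases "h x = \<delta>") (auto simp: le_max_iff_disj)
    then show False
      using x bspec[OF h x(1)] by (meson leD order_trans)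
  qed
  then show thesis using \<pi> that by blast
qed

section \<open>Mathias forcing\<close>

sublocale M: preorder_forcing "mathias U" mathias_le
  by unfold_locales (auto intro: mathias_le_refl mathias_le_trans)

text \<open>\<open>ord_sup\<close> is a \<open>LEAST\<close>, so an upper bound must first be shown
  to exist.\<close>

lemma le_ord_sup:
  fixes a :: "'k set"
  assumes "|a| <o |UNIV :: 'k set|" and "x \<in> a"
  shows "x \<le> ord_sup a"
proof -
  have "\<exists>b. \<forall>x\<in>a. x \<le> b"
    using bounded_if_small[OF assms(1), of "\<lambda>x. x"] .
  then have "\<forall>x\<in>a. x \<le> ord_sup a"
    unfolding ord_sup_def by (rule LeastI_ex)
  then show ?thesis using assms(2) by blast
qed

lemma mathias_iff:
  "(a, A) \<in> mathias U \<longleftrightarrow>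
     |a| <o |UNIV :: 'k set| \<and> A \<in> U \<and> (\<forall>y\<in>A. ord_sup a < y)"
proof -
  have "ord_sup a < (LEAST y. y \<in> A) \<longleftrightarrow> (\<forall>y\<in>A. ord_sup a < y)" if "A \<in> U"
  proof -
    have "(LEAST y. y \<in> A) \<in> A"
      using U_nonempty[OF that] by (auto intro: LeastI)
    then show ?thesis
      by (meson Least_le order_less_le_trans)
  qed
  then show ?thesis
    unfolding mathias_def by auto
qed

lemma mathias_shrink:
  assumes "(a, A) \<in> mathias U" and "B \<in> U"
  shows "(a, A \<inter> B) \<in> mathias U" and "mathias_le (a, A \<inter> B) (a, A)"
  using assms U_Int
  by (auto simp: mathias_iff mathias_le_def initial_segment_def)

text \<open>All of \<open>a\<close> lies below \<open>x\<close>, so adding \<open>x\<close> is an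
  end-extension; cutting \<open>A\<close> to the tail above \<open>x\<close> keeps it above the new
  supremum.\<close>

lemma mathias_extend:
  assumes p: "(a, A) \<in> mathias U" and x: "x \<in> A"
  shows "(insert x a, A \<inter> {x<..}) \<in> mathias U"
    and "mathias_le (insert x a, A \<inter> {x<..}) (a, A)"
proof -
  have a: "y < x" if "y \<in> a" for y
    using le_ord_sup[of a y] that p x by (auto simp: mathias_iff)
  have "ord_sup (insert x a) \<le> x"
    unfolding ord_sup_def using a by (intro Least_le) (auto simp: less_imp_le)
  moreover have "|insert x a| <o |UNIV :: 'k set|"
  proof -
    have "|{x}| <o |UNIV :: 'k set|"
      by (intro card_of_finite_ordLess_infinite infinite_kappa) simp
    moreover have "|a| <o |UNIV :: 'k set|"
      using p by (simp add: mathias_iff)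
    ultimately have "|{x} \<union> a| <o |UNIV :: 'k set|"
      by (rule card_of_Un_ordLess_infinite[OF infinite_kappa])
    then show ?thesis by simp
  qed
  ultimately show "(insert x a, A \<inter> {x<..}) \<in> mathias U"
    using p by (auto simp: mathias_iff intro: U_Int greaterThan_in_U)
  show "mathias_le (insert x a, A \<inter> {x<..}) (a, A)"
    using a x by (auto simp: mathias_le_def initial_segment_def dest: less_asym)
qed

text \<open>\<open>forced\<close> quantifies over conditions, so over an empty forcing
  \<open>canjar\<close> would hold vacuously.\<close>

lemma mathias_nonempty: "mathias U \<noteq> {}"
proof -
  have "({}, {ord_sup {}<..}) \<in> mathias U"
    by (auto simp: mathias_iff greaterThan_in_U infinite_kappa intro: card_of_finite_ordLess_infinite)
  then show ?thesis by blast
qed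

section \<open>The generic function and its domination\<close>

definition decides :: "('k \<Rightarrow> 'k) \<Rightarrow> 'k set \<times> 'k set \<Rightarrow> 'k \<Rightarrow> 'k \<Rightarrow> bool" where
  "decides \<pi> p \<alpha> \<beta> \<longleftrightarrow>
     (\<exists>x\<in>fst p. \<alpha> < \<pi> x \<and> \<beta> = \<pi> x \<and> (\<forall>y\<in>fst p. y < x \<longrightarrow> \<pi> y \<le> \<alpha>))"

text \<open>A stronger condition end-extends the stem \<open>fst p\<close>, so no new element
  appears before the deciding \<open>x\<close>.\<close>

lemma decides_mono: "mathias_le q p \<Longrightarrow> decides \<pi> p \<alpha> \<beta> \<Longrightarrow> decides \<pi> q \<alpha> \<beta>"
  unfolding decides_def mathias_le_def initial_segment_def
  by (cases p; cases q) (simp, blast)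

lemma decides_unique: "decides \<pi> p \<alpha> \<beta> \<Longrightarrow> decides \<pi> p \<alpha> \<beta>' \<Longrightarrow> \<beta> = \<beta>'"
  unfolding decides_def by (metis leD linorder_less_linear)

lemma decides_dense:
  assumes "unbounded \<pi>" and p: "p \<in> mathias U"
  shows "\<exists>q\<in>mathias U. mathias_le q p \<and> (\<exists>\<beta>. decides \<pi> q \<alpha> \<beta>)"
proof -
  obtain a A where aA: "p = (a, A)" by fastforce
  have "A \<inter> {x. \<alpha> < \<pi> x} \<in> U"
    using assms unfolding aA mathias_iff unbounded_def by (blast intro: U_Int)
  then obtain x where x: "x \<in> A" "\<alpha> < \<pi> x"
    using U_nonempty by blast
  \<comment> \<open>The new \<open>x\<close> guarantees a value above \<alpha>, but the stem may
    already contain an earlier element with that property; the least one decides.\<close>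
  define y where "y = (LEAST y. y \<in> insert x a \<and> \<alpha> < \<pi> y)"
  have "y \<in> insert x a \<and> \<alpha> < \<pi> y"
    unfolding y_def by (rule LeastI[of _ x]) (simp add: x)
  moreover have "\<pi> z \<le> \<alpha>" if "z \<in> insert x a" "z < y" for z
    using that not_less_Least unfolding y_def by (metis (mono_tags, lifting) not_le)
  ultimately have "decides \<pi> (insert x a, A \<inter> {x<..}) \<alpha> (\<pi> y)"
    unfolding decides_def by auto
  then show ?thesis
    using mathias_extend p x unfolding aA by blast
qed

text \<open>Shrinking \<open>A\<close> to the set of points closed under \<open>g\<close> puts every
  element added later into that set, so only the old stem \<open>a\<close> can decide values badly,
  and \<pi> is bounded on it.\<close>

lemma forces_le_star:
  assumes \<pi>: "unbounded \<pi>" and closed: "{x. \<forall>\<alpha><\<pi> x. g \<alpha> < \<pi> x} \<in> U"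
  shows "M.f_le_star g (M.function_name (decides \<pi>)) p"
proof -
  let ?C = "{x. \<forall>\<alpha><\<pi> x. g \<alpha> < \<pi> x}"
  let ?f = "M.function_name (decides \<pi>)"
  have dominated: "\<exists>\<gamma>. \<exists>r\<in>mathias U. mathias_le r q \<and>
      (\<forall>\<alpha>\<ge>\<gamma>. \<forall>s\<in>mathias U. mathias_le s r \<longrightarrow>
        (\<exists>\<beta>. \<exists>t\<in>mathias U. mathias_le t s \<and> M.f_val ?f \<alpha> \<beta> t \<and> g \<alpha> \<le> \<beta>))"
    if q: "q \<in> mathias U" for q
  proof -
    obtain a A where aA: "q = (a, A)" by fastforce
    obtain \<gamma> where \<gamma>: "\<And>x. x \<in> a \<Longrightarrow> \<pi> x \<le> \<gamma>"
      using q bounded_if_small[of a \<pi>] unfolding aA mathias_iff by blast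
    have "\<exists>\<beta>. \<exists>t\<in>mathias U. mathias_le t s \<and> M.f_val ?f \<alpha> \<beta> t \<and> g \<alpha> \<le> \<beta>"
      if "\<gamma> \<le> \<alpha>" and s: "s \<in> mathias U" "mathias_le s (a, A \<inter> ?C)" for \<alpha> s
    proof -
      obtain t \<beta> where t: "t \<in> mathias U" "mathias_le t s" "decides \<pi> t \<alpha> \<beta>"
        using decides_dense[OF \<pi> s(1)] by blast
      then obtain x where x: "x \<in> fst t" "\<alpha> < \<pi> x" "\<beta> = \<pi> x"
        unfolding decides_def by blast
      \<comment> \<open>Since \<gamma> bounds \<pi> on \<open>a\<close> and \<gamma> \<le> \<alpha>
        < \<pi> x, the deciding element is a later one; closure at \<alpha> then gives g \<alpha> <
        \<pi> x.\<close>
      then have "x \<notin> a"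
        using \<gamma> \<open>\<gamma> \<le> \<alpha>\<close> by (meson leD order_trans)
      moreover have "mathias_le t (a, A \<inter> ?C)"
        using t s mathias_le_trans by blast
      ultimately have "x \<in> ?C"
        using x unfolding mathias_le_def by (cases t) auto
      then have "g \<alpha> \<le> \<beta>"
        using x by (simp add: less_imp_le)
      then show ?thesis
        using t M.f_val_function_name_intro[OF infinite_kappa] by blast
    qed
    then show ?thesis
      using mathias_shrink[OF _ closed] q unfolding aA by blast
  qed
  show ?thesis
    unfolding M.f_le_star_def M.f_ex_iff[of _ _ p]
  proof (intro ballI impI)
    fix q assume "q \<in> mathias U"
    from dominated[OF this] obtain \<gamma> r where r: "r \<in> mathias U" "mathias_le r q"
      and dom: "\<And>\<alpha> s. \<gamma> \<le> \<alpha> \<Longrightarrow> s \<in> mathias U \<Longrightarrow> mathias_le s r \<Longrightarrow>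
        \<exists>\<beta>. \<exists>t\<in>mathias U. mathias_le t s \<and> M.f_val ?f \<alpha> \<beta> t \<and> g \<alpha> \<le> \<beta>"
      by blast
    have "M.f_ex UNIV (\<lambda>\<beta>. M.f_and (M.f_val ?f \<alpha> \<beta>) (M.f_ground (g \<alpha> \<le> \<beta>))) s"
      if "\<gamma> \<le> \<alpha>" "mathias_le s r" for \<alpha> s
      unfolding M.f_ex_iff M.f_and_def M.f_ground_def
      using dom[OF that(1)] mathias_le_trans[OF _ that(2)] by blast
    then have "M.f_all UNIV (\<lambda>\<alpha>. M.f_imp (M.f_ground (\<gamma> \<le> \<alpha>))
        (M.f_ex UNIV (\<lambda>\<beta>. M.f_and (M.f_val ?f \<alpha> \<beta>) (M.f_ground (g \<alpha> \<le> \<beta>))))) r"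
      unfolding M.f_all_def M.f_imp_iff M.f_ground_def using mathias_le_refl by blast
    then show "\<exists>\<gamma>\<in>UNIV. \<exists>r\<in>mathias U. mathias_le r q \<and>
        M.f_all UNIV (\<lambda>\<alpha>. M.f_imp (M.f_ground (\<gamma> \<le> \<alpha>))
          (M.f_ex UNIV (\<lambda>\<beta>. M.f_and (M.f_val ?f \<alpha> \<beta>) (M.f_ground (g \<alpha> \<le> \<beta>))))) r"
      using r by blast
  qed
qed

text \<open>\<pi> is chosen before \<open>g\<close>, so a single name is dominating at every
  condition.\<close>

lemma mathias_adds_dominating: "mathias_adds_dominating U"
proof -
  obtain \<pi> where \<pi>: "unbounded \<pi>" "\<And>g. {x. \<forall>\<alpha><\<pi> x. g \<alpha> < \<pi> x} \<in> U"
    using exists_unbounded_closed by blast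
  have "M.f_function (M.function_name (decides \<pi>)) p" for p
    using infinite_kappa decides_mono decides_unique decides_dense[OF \<pi>(1)]
    by (rule M.f_function_function_name)
  then have "M.f_dominating (M.function_name (decides \<pi>)) p" for p
    unfolding M.f_dominating_def M.f_and_def M.f_all_def
    using forces_le_star[OF \<pi>] by blast
  then show ?thesis
    unfolding mathias_adds_dominating_def M.forced_def M.f_ex_iff
    using M.is_name_function_name[OF infinite_kappa] mathias_le_refl by blast
qed

text \<open>Some condition exists, and it cannot force both the existence of a dominating function
  and its negation.\<close>

lemma not_canjar: "\<not> canjar U"
  using mathias_adds_dominating mathias_nonempty mathias_le_refl
  unfolding mathias_adds_dominating_def canjar_def M.forced_def M.f_not_def by blast

end

theorem theorem3p14:
  fixes U :: "'k::wellorder set set"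
  assumes "measurable_cardinal TYPE('k)"
    and "ultrafilter_over U" and "nonprincipal U" and "kappa_complete U"
  shows "mathias_adds_dominating U \<and> \<not> canjar U"
proof -
  interpret complete_ultrafilter U
    using assms unfolding measurable_cardinal_def by unfold_locales auto
  show ?thesis
    using mathias_adds_dominating not_canjar by blast
qed

end
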